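(* Let $(X_i)_{i\in\mathbb{N}}$ be an i.i.d. family with values in $\mathbb{R}^d$. Then $\Lambda(\lambda):=\ln\big(\mathbb{E}[e^{\langle\lambda,X_1\rangle}]\big)<\infty$ for all $\lambda\in\mathbb{R}^d$ implies that $$\lim_{n\to\infty}\frac1n\sum_{i=1}^nX_i=\mathbb{E}[X_1]\qquad\text{almost surely}$$ with exponential mean deviation frequency in the following sense: for any $\varepsilon>0$, $$\mathcal{O}_\varepsilon:=\sum_{n=1}^\infty\mathbf{1}\Big\{\Big|\frac1n\sum_{i=1}^nX_i-\mathbb{E}[X_1]\Big|\geqslant\varepsilon\Big\}$$ and $0<p<\inf_{|\lambda^*|>\varepsilon}\Lambda^*(\lambda^* )$ there is a constant $C_{\varepsilon,p}>0$ such that $$\mathbb{E}\big[e^{p\mathcal{O}_\varepsilon}\big]\leqslant C_{\varepsilon,p}\Big(1-\exp\big(-\inf_{|\lambda^*|>\varepsilon}\Lambda^*(\lambda^* )\big)\Big)^{-1}\Big(1-\exp\big(-(\inf_{|\lambda^*|>\varepsilon}\Lambda^*(\lambda^* )-p)\big)\Big)^{-1}=:K_{\varepsilon,p}<\infty,$$ where $\Lambda^*$ is the Fenchel–Legendre transform of $\Lambda$. Additionally, $\mathbb{P}(\mathcal{O}_\varepsilon\geqslant k)\leqslant K_{\varepsilon,p}\cdot\exp(-pk)$ for all $k\in\mathbb{N}$.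
   Context: $\mathbb{N}=\{1,2,\dots\}$. The random vectors $X_i$ are defined on a probability space $(\Omega,\mathcal{A},\mathbb{P})$. $\langle\cdot,\cdot\rangle$ is the Euclidean inner product on $\mathbb{R}^d$, and the Fenchel–Legendre transform is $\Lambda^*(x):=\sup_{\lambda\in\mathbb{R}^d}(\langle\lambda,x\rangle-\Lambda(\lambda))$, $x\in\mathbb{R}^d$.
   Formalization: Each infimum of Λ* over |λ*|>ε is replaced by the infimum over |λ*−E[X_1]|≥ε (closed and centred at the mean), since the printed bound fails, e.g. for X_i=±1 with probability 1/2, ε=1 and p≥ln 2. *)

theory Defs
  imports "HOL-Probability.Probability"
begin

text \<open>
  The exponential and the logarithm on the extended line, with the usual conventions
  \<open>exp (-\<infinity>) = 0\<close>, \<open>exp \<infinity> = \<infinity>\<close>, \<open>ln 0 = -\<infinity>\<close>, \<open>ln \<infinity> = \<infinity>\<close>. Infinite arguments do occur: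
  the deviation count is infinite on an event that only turns out to be null, and the Legendre
  transform is infinite off the closed convex hull of the support.
\<close>

definition exp_ereal :: "ereal \<Rightarrow> ennreal" where
  "exp_ereal x = (case x of ereal r \<Rightarrow> ennreal (exp r) | PInfty \<Rightarrow> top | MInfty \<Rightarrow> 0)"

definition ln_ennreal :: "ennreal \<Rightarrow> ereal" where
  "ln_ennreal x = (if x = 0 then -\<infinity> else if x = top then \<infinity> else ereal (ln (enn2real x)))"

definition cumulant :: "'a measure \<Rightarrow> ('a \<Rightarrow> real ^ 'd) \<Rightarrow> real ^ 'd \<Rightarrow> ereal" where
  "cumulant M Y l = ln_ennreal (\<integral>\<^sup>+\<omega>. ennreal (exp (l \<bullet> Y \<omega>)) \<partial>M)"

definition legendre :: "(real ^ 'd \<Rightarrow> ereal) \<Rightarrow> real ^ 'd \<Rightarrow> ereal" where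
  "legendre L x = (SUP l. ereal (l \<bullet> x) - L l)"

definition sample_mean :: "(nat \<Rightarrow> 'a \<Rightarrow> real ^ 'd) \<Rightarrow> nat \<Rightarrow> 'a \<Rightarrow> real ^ 'd" where
  "sample_mean X n \<omega> = (1 / real n) *\<^sub>R (\<Sum>i=1..n. X i \<omega>)"

definition iid :: "'a measure \<Rightarrow> (nat \<Rightarrow> 'a \<Rightarrow> real ^ 'd) \<Rightarrow> bool" where
  "iid M X \<longleftrightarrow> prob_space.indep_vars M (\<lambda>_. borel) X {1..} \<and>
     (\<forall>i\<ge>1. distr M borel (X i) = distr M borel (X 1))"

text \<open>The summation index is shifted, so that the sum runs over the sample sizes \<open>1, 2, \<dots>\<close>\<close>

definition dev_count ::
    "'a measure \<Rightarrow> (nat \<Rightarrow> 'a \<Rightarrow> real ^ 'd) \<Rightarrow> real \<Rightarrow> 'a \<Rightarrow> ennreal" where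
  "dev_count M X \<epsilon> \<omega> =
     (\<Sum>n. indicator {\<omega>'. norm (sample_mean X (Suc n) \<omega>' - (\<integral>\<omega>''. X 1 \<omega>'' \<partial>M)) \<ge> \<epsilon>} \<omega>)"

text \<open>
  The infimum is over the closed set of deviations from the mean that \<open>dev_count\<close> counts. For the
  infimum over \<open>norm x > \<epsilon>\<close> the exponential moment bound fails. Let \<open>\<epsilon> = 1\<close> and \<open>d = 1\<close>, so that
  this infimum is \<open>\<infinity>\<close> for variables with values in \<open>{-1, 1}\<close>.
  \<^item> If \<open>X i = -1\<close> has probability 1/2, the mean is 0, but \<open>dev_count \<ge> n\<close> has probability at least
    \<open>(1/2) ^ n\<close>, so the moment is infinite for \<open>p \<ge> ln 2\<close>: the set must be closed.
  \<^item> If \<open>X i = -1\<close> has probability 1/4, the mean is 1/2 and all the variables up to \<open>n\<close> equal \<open>-1\<close>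
    with probability \<open>(1/4) ^ n\<close>, so the moment is infinite for \<open>p \<ge> ln 4\<close>, also if only deviations
    strictly greater than \<open>\<epsilon>\<close> are counted: the set must be centred at the mean.
\<close>

definition dev_rate :: "'a measure \<Rightarrow> (nat \<Rightarrow> 'a \<Rightarrow> real ^ 'd) \<Rightarrow> real \<Rightarrow> ereal" where
  "dev_rate M X \<epsilon> =
     (INF x \<in> {x. norm (x - (\<integral>\<omega>. X 1 \<omega> \<partial>M)) \<ge> \<epsilon>}. legendre (cumulant M (X 1)) x)"

text \<open>
  The value is in \<open>ennreal\<close>, where \<open>inverse 0 = \<infinity>\<close>, so that finiteness of the
  bound is a statement with content.
\<close>

definition dev_bound ::
    "'a measure \<Rightarrow> (nat \<Rightarrow> 'a \<Rightarrow> real ^ 'd) \<Rightarrow> real \<Rightarrow> real \<Rightarrow> real \<Rightarrow> ennreal" where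
  "dev_bound M X \<epsilon> p C =
     ennreal C * inverse (1 - exp_ereal (- dev_rate M X \<epsilon>))
               * inverse (1 - exp_ereal (- (dev_rate M X \<epsilon> - ereal p)))"

end

theory Submission
  imports Defs
begin

text \<open>
  Everything rests on an exponential bound for the probability that the sample mean \<open>S\<^sub>n / n\<close>
  deviates from the mean \<open>\<mu>\<close> by at least \<open>\<epsilon>\<close>. Chernoff's inequality gives it for a half-space:
  since \<open>E[exp (l \<bullet> S\<^sub>n)] = exp (n * \<Lambda> l)\<close> by independence, the sample mean lies in
  \<open>{x. q < l \<bullet> x - \<Lambda> l}\<close> with probability at most \<open>exp (- q * n)\<close> (\<open>half_space_Chernoff\<close>).
  If \<open>q\<close> is smaller than the infimum of the Legendre transform over a closed set, then such
  half-spaces cover that set. Finitely many of them suffice (\<open>finite_half_space_cover\<close>): the ones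
  with \<open>l = \<plusminus> b\<close> for basis vectors \<open>b\<close> leave only a bounded part uncovered, which is compact. Hence
  the deviation has probability at most \<open>c * exp (- q * n)\<close> for some \<open>c\<close> (\<open>prob_deviation_le\<close>).

  For the exponential moment let \<open>p\<close> be smaller than the rate and choose \<open>q\<close> strictly in between.
  If \<open>N\<close> is the last sample size at which a deviation occurs, there are at most \<open>N\<close> deviations, so
  that the exponential of \<open>p\<close> times their number is at most 1 plus the sum of \<open>exp (p * n)\<close> over the
  sample sizes \<open>n\<close> with a deviation (\<open>exp_count_le\<close>). The expectation of this sum is dominated by a
  geometric series with ratio \<open>exp (p - q)\<close>. The two inverse factors of the bound are finite and at
  least 1, so any constant above the exponential moment will do; the tail estimate is Markov's
  inequality.

  The strong law is the same bound combined with the Borel-Cantelli lemma, once some positive \<open>q\<close> is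
  available. It comes from the second-order estimate \<open>\<Lambda> l \<le> l \<bullet> \<mu> + K * (norm l)\<^sup>2\<close> near the
  origin (\<open>cumulant_le_quadratic\<close>): a short vector \<open>l\<close> in the direction of \<open>x - \<mu>\<close> makes
  \<open>l \<bullet> x - \<Lambda> l\<close> positive, uniformly for \<open>norm (x - \<mu>) \<ge> \<epsilon>\<close> (\<open>deviation_separation\<close>).
\<close>

section \<open>Exponential moments of a count of rare events\<close>

lemma exp_ereal_0: "exp_ereal 0 = 1"
  by (simp add: exp_ereal_def zero_ereal_def)

lemma exp_ereal_mono: "x \<le> y \<Longrightarrow> exp_ereal x \<le> exp_ereal y"
  by (cases x; cases y) (auto simp: exp_ereal_def ennreal_leI)

lemma inverse_one_minus_exp_ereal:
  assumes "x < 0"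
  shows "1 \<le> inverse (1 - exp_ereal x)" "inverse (1 - exp_ereal x) < top"
proof -
  obtain r where r: "exp_ereal x = ennreal r" "0 \<le> r" "r < 1"
  proof (cases x)
    case (real y)
    with assms show thesis by (intro that[of "exp y"]) (auto simp: exp_ereal_def)
  qed (use assms that[of 0] in \<open>auto simp: exp_ereal_def\<close>)
  have "1 - exp_ereal x = ennreal (1 - r)"
    using r by (simp add: ennreal_minus flip: ennreal_1)
  then have "inverse (1 - exp_ereal x) = ennreal (inverse (1 - r))"
    using r by (simp add: inverse_ennreal)
  then show "1 \<le> inverse (1 - exp_ereal x)" "inverse (1 - exp_ereal x) < top"
    using r by (simp_all add: one_le_inverse)
qed

text \<open>
  If the last event that occurs is \<open>A N\<close>, at most \<open>Suc N\<close> events occur, and the term with index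
  \<open>N\<close> alone dominates the left-hand side. If infinitely many occur, the series diverges because all
  its nonzero terms are at least 1. The right-hand side is linear in the indicators, so that only the
  probabilities of the individual events enter its expectation.
\<close>

lemma exp_count_le:
  fixes A :: "nat \<Rightarrow> 'a set"
  assumes "p \<ge> 0"
  shows "exp_ereal (ereal p * enn2ereal (\<Sum>n. indicator (A n) \<omega>))
    \<le> 1 + (\<Sum>n. ennreal (exp (p * real (Suc n))) * indicator (A n) \<omega>)"
    (is "exp_ereal (_ * enn2ereal ?count) \<le> 1 + ?R")
proof -
  define S where "S = {n. \<omega> \<in> A n}"
  \<comment> \<open>The series of indicators is the counting measure of the set of indices.\<close>
  have "?count = (\<integral>\<^sup>+n. indicator S n \<partial>count_space UNIV)"
    by (simp add: nn_integral_count_space_nat S_def indicator_def)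
  then have count: "?count = emeasure (count_space UNIV) S"
    by simp
  have exp_ge_1: "1 \<le> ennreal (exp (p * real (Suc n)))" for n
    using assms by (simp del: of_nat_Suc flip: ennreal_1)
  have term_le: "f k \<le> (\<Sum>n. f n)" for f :: "nat \<Rightarrow> ennreal" and k
    using sum_le_suminf[of f "{k}"] by simp
  show ?thesis
  proof (cases "finite S")
    case False
    have "?count \<le> ?R"
      using mult_right_mono[OF exp_ge_1] by (intro suminf_le) auto
    then show ?thesis using False count by (simp add: top_unique)
  next
    case True
    show ?thesis
    proof (cases "S = {}")
      case True
      then show ?thesis using count by (simp add: exp_ereal_0 zero_ennreal.rep_eq)
    next
      case False
      have "S \<subseteq> {..Max S}" using \<open>finite S\<close> by auto
      from card_mono[OF _ this] have "card S \<le> Suc (Max S)" by simp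
      then have "exp_ereal (ereal p * enn2ereal ?count) \<le> ennreal (exp (p * real (Suc (Max S))))"
        using \<open>finite S\<close> assms count
        by (simp add: exp_ereal_def ennreal_of_nat_eq_real_of_nat mult_left_mono del: of_nat_Suc)
      also have "\<dots> = ennreal (exp (p * real (Suc (Max S)))) * indicator (A (Max S)) \<omega>"
        using Max_in[OF \<open>finite S\<close> False] by (simp add: S_def)
      also have "\<dots> \<le> ?R"
        by (rule term_le)
      also have "\<dots> \<le> 1 + ?R" by simp
      finally show ?thesis .
    qed
  qed
qed

lemma (in prob_space) exp_moment_count_finite:
  assumes A: "\<And>n. A n \<in> events"
    and prob: "\<And>n. prob (A n) \<le> c * exp (- q * real (Suc n))"
    and "0 \<le> p" "p < q"
  shows "(\<integral>\<^sup>+\<omega>. exp_ereal (ereal p * enn2ereal (\<Sum>n. indicator (A n) \<omega>)) \<partial>M) < top"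
proof -
  let ?r = "exp (p - q)"
  have "0 \<le> c * exp (- q * real (Suc 0))"
    using prob[of 0] measure_nonneg order_trans by blast
  then have "c \<ge> 0" by (simp add: zero_le_mult_iff)
  have term_le: "ennreal (exp (p * real (Suc n))) * emeasure M (A n) \<le> ennreal (c * ?r * ?r ^ n)" for n
  proof -
    have "ennreal (exp (p * real (Suc n))) * emeasure M (A n)
        = ennreal (exp (p * real (Suc n)) * prob (A n))"
      by (simp add: emeasure_eq_measure ennreal_mult)
    also have "\<dots> \<le> ennreal (exp (p * real (Suc n)) * (c * exp (- q * real (Suc n))))"
      by (intro ennreal_leI mult_left_mono prob) auto
    also have "exp (p * real (Suc n)) * (c * exp (- q * real (Suc n))) = c * exp (real (Suc n) * (p - q))"
      by (simp add: algebra_simps flip: exp_add)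
    also have "\<dots> = c * ?r * ?r ^ n"
      by (simp only: exp_of_nat_mult) simp
    finally show ?thesis .
  qed
  have "(\<integral>\<^sup>+\<omega>. exp_ereal (ereal p * enn2ereal (\<Sum>n. indicator (A n) \<omega>)) \<partial>M)
      \<le> (\<integral>\<^sup>+\<omega>. 1 + (\<Sum>n. ennreal (exp (p * real (Suc n))) * indicator (A n) \<omega>) \<partial>M)"
    by (intro nn_integral_mono exp_count_le assms)
  also have "\<dots> = 1 + (\<Sum>n. ennreal (exp (p * real (Suc n))) * emeasure M (A n))"
    using A by (simp add: nn_integral_add nn_integral_suminf nn_integral_cmult_indicator
        emeasure_space_1 del: of_nat_Suc)
  also have "\<dots> \<le> 1 + (\<Sum>n. ennreal (c * ?r * ?r ^ n))"
    by (intro add_left_mono suminf_le term_le) auto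
  also have "\<dots> < top"
  proof -
    have "summable (\<lambda>n. c * ?r * ?r ^ n)"
      using \<open>p < q\<close> by (intro summable_mult summable_geometric) auto
    then have "(\<Sum>n. ennreal (c * ?r * ?r ^ n)) = ennreal (\<Sum>n. c * ?r * ?r ^ n)"
      using \<open>c \<ge> 0\<close> by (intro suminf_ennreal2) auto
    then show ?thesis by (simp only: ennreal_add_less_top ennreal_less_top ennreal_one_less_top simp_thms)
  qed
  finally show ?thesis .
qed

section \<open>Covering a closed set by finitely many half-spaces\<close>

text \<open>
  Compactness yields a finite subcover of a bounded part of the set. The unbounded rest is covered by
  the half-spaces of the vectors \<open>\<plusminus> b\<close> with \<open>b\<close> in the basis: whatever the values of \<open>\<Lambda>\<close>, their
  complement is contained in a box.
\<close>

lemma finite_half_space_cover: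
  fixes F :: "'b::euclidean_space set" and \<Lambda> :: "'b \<Rightarrow> real"
  assumes "closed F" and cover: "\<And>x. x \<in> F \<Longrightarrow> \<exists>l. q < l \<bullet> x - \<Lambda> l"
  obtains T where "finite T" "F \<subseteq> (\<Union>l\<in>T. {x. q < l \<bullet> x - \<Lambda> l})"
proof -
  define H where "H l = {x. q < l \<bullet> x - \<Lambda> l}" for l
  have open_H: "open (H l)" for l
    unfolding H_def by (intro open_Collect_less continuous_intros)
  define B where "B = (Basis :: 'b set) \<union> uminus ` Basis"
  define R where "R = (\<Sum>l\<in>B. \<bar>q + \<Lambda> l\<bar>)"
  have "finite B" by (simp add: B_def)
  define K where "K = F - (\<Union>l\<in>B. H l)"
  have "compact K"
    unfolding compact_eq_bounded_closed
  proof
    show "closed K"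
      unfolding K_def using \<open>closed F\<close> open_H by (intro closed_Diff open_UN) auto
    have "\<bar>x \<bullet> b\<bar> \<le> R" if "x \<in> K" "b \<in> Basis" for x b
    proof -
      have "l \<bullet> x \<le> R" if "l \<in> B" for l
      proof -
        have "l \<bullet> x \<le> q + \<Lambda> l" using \<open>x \<in> K\<close> that by (force simp: K_def H_def)
        also have "\<dots> \<le> R"
          unfolding R_def using member_le_sum[OF that, of "\<lambda>l. \<bar>q + \<Lambda> l\<bar>"] \<open>finite B\<close> by force
        finally show ?thesis .
      qed
      from this[of b] this[of "- b"] \<open>b \<in> Basis\<close> show ?thesis
        by (auto simp: B_def inner_commute abs_le_iff)
    qed
    then have "norm x \<le> (\<Sum>b\<in>(Basis::'b set). R)" if "x \<in> K" for x
      using that by (intro order_trans[OF norm_le_l1] sum_mono)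
    then show "bounded K" by (auto simp: bounded_iff)
  qed
  moreover have "K \<subseteq> (\<Union>l\<in>UNIV. H l)"
    using cover by (auto simp: K_def H_def)
  ultimately obtain T where "finite T" "K \<subseteq> (\<Union>l\<in>T. H l)"
    using open_H compactE_image[of K UNIV H] by (metis subset_UNIV)
  then have "F \<subseteq> (\<Union>l\<in>T \<union> B. H l)" by (auto simp: K_def)
  with \<open>finite T\<close> \<open>finite B\<close> show thesis
    using that[of "T \<union> B"] by (auto simp: H_def)
qed

section \<open>The exponential rate of deviations of the sample mean\<close>

text \<open>
  The norm is at most the dimension times the largest modulus of a coordinate. Thus finiteness of the
  moment generating function at finitely many points controls the exponential moments of the norm.
\<close>

lemma exp_norm_le_sum_Basis:
  fixes x :: "'b::euclidean_space"
  shows "exp (norm x) \<le>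
    (\<Sum>b\<in>Basis. exp ((real DIM('b) *\<^sub>R b) \<bullet> x) + exp ((- real DIM('b) *\<^sub>R b) \<bullet> x))"
proof -
  obtain b :: 'b where b: "b \<in> Basis" "norm x \<le> real DIM('b) * \<bar>x \<bullet> b\<bar>"
  proof (rule ccontr)
    assume "\<not> thesis"
    then have "\<And>b. b \<in> Basis \<Longrightarrow> \<bar>x \<bullet> b\<bar> < norm x / real DIM('b)"
      using that by (force simp: field_simps)
    then have "(\<Sum>b\<in>Basis. \<bar>x \<bullet> b\<bar>) < (\<Sum>b\<in>(Basis :: 'b set). norm x / real DIM('b))"
      by (intro sum_strict_mono) auto
    with norm_le_l1[of x] show False by simp
  qed
  have "exp (norm x) \<le> exp (real DIM('b) * \<bar>x \<bullet> b\<bar>)" using b by simp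
  also have "\<dots> \<le> exp ((real DIM('b) *\<^sub>R b) \<bullet> x) + exp ((- real DIM('b) *\<^sub>R b) \<bullet> x)"
    by (cases "x \<bullet> b \<ge> 0") (auto simp: inner_commute)
  also have "\<dots> \<le> (\<Sum>b\<in>Basis. exp ((real DIM('b) *\<^sub>R b) \<bullet> x) + exp ((- real DIM('b) *\<^sub>R b) \<bullet> x))"
    using b(1) member_le_sum[of b Basis
      "\<lambda>b. exp ((real DIM('b) *\<^sub>R b) \<bullet> x) + exp ((- real DIM('b) *\<^sub>R b) \<bullet> x)"]
    by (force intro: add_nonneg_nonneg)
  finally show ?thesis .
qed

text \<open>
  Taylor's formula of order 2 for the exponential, with \<open>(norm y)\<^sup>2 / 2 \<le> exp (norm y)\<close>
  absorbing the square into the exponential. The remainder is quadratic in \<open>l\<close> with a factor that depends on \<open>y\<close> only, which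
  is what remains uniform in \<open>l\<close> when \<open>y\<close> is averaged.
\<close>

lemma exp_inner_le_quadratic:
  fixes l y :: "'b::real_inner"
  assumes "norm l \<le> 1"
  shows "exp (l \<bullet> y) \<le> 1 + l \<bullet> y + (norm l)\<^sup>2 * exp (2 * norm y)"
proof -
  have le: "\<bar>l \<bullet> y\<bar> \<le> norm l * norm y" by (rule Cauchy_Schwarz_ineq2)
  also have "\<dots> \<le> 1 * norm y" using assms by (intro mult_right_mono) auto
  finally have le': "\<bar>l \<bullet> y\<bar> \<le> norm y" by simp
  obtain t where t: "\<bar>t\<bar> \<le> \<bar>l \<bullet> y\<bar>"
      "exp (l \<bullet> y) = (\<Sum>m<2. (l \<bullet> y) ^ m / fact m) + exp t / fact 2 * (l \<bullet> y)\<^sup>2"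
    using Maclaurin_exp_le by blast
  have "(l \<bullet> y)\<^sup>2 \<le> (norm l * norm y)\<^sup>2"
    using le by (metis abs_ge_zero power2_abs power_mono)
  moreover have "exp t \<le> exp (norm y)" using t(1) le' by simp
  ultimately have "exp t / 2 * (l \<bullet> y)\<^sup>2 \<le> exp (norm y) / 2 * (norm l * norm y)\<^sup>2"
    by (intro mult_mono) auto
  also have "\<dots> = (norm l)\<^sup>2 * (exp (norm y) * ((norm y)\<^sup>2 / 2))"
    by (simp add: power_mult_distrib)
  also have "\<dots> \<le> (norm l)\<^sup>2 * (exp (norm y) * exp (norm y))"
    using exp_lower_Taylor_quadratic[of "norm y"] norm_ge_zero[of y]
    by (intro mult_left_mono) (linarith | simp)+
  also have "exp (norm y) * exp (norm y) = exp (2 * norm y)"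
    by (simp flip: exp_add)
  finally show ?thesis using t(2) by (simp add: numeral_2_eq_2)
qed

text \<open>
  The cumulant generating function enters as the real-valued function \<open>\<Lambda>\<close>, which the finiteness of
  all exponential moments provides; this keeps extended real arithmetic out of the probabilistic
  estimates.
\<close>

locale iid_exponential_moments = prob_space M for M :: "'a measure" +
  fixes X :: "nat \<Rightarrow> 'a \<Rightarrow> real ^ 'd" and \<Lambda> :: "real ^ 'd \<Rightarrow> real"
  assumes iid: "iid M X"
    and mgf: "(\<integral>\<^sup>+\<omega>. ennreal (exp (l \<bullet> X 1 \<omega>)) \<partial>M) = ennreal (exp (\<Lambda> l))"
begin

abbreviation "\<mu> \<equiv> \<integral>\<omega>. X 1 \<omega> \<partial>M"

lemma indep_X: "indep_vars (\<lambda>_. borel) X {1..}"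
  using iid unfolding iid_def by (rule conjunct1)

lemma measurable_X: "i \<ge> 1 \<Longrightarrow> X i \<in> borel_measurable M"
  using indep_X by (auto simp: indep_vars_def)

lemma measurable_sample_mean: "sample_mean X n \<in> borel_measurable M"
  unfolding sample_mean_def[abs_def]
  using measurable_X by (intro borel_measurable_scaleR borel_measurable_sum) auto

lemma mgf_identical:
  assumes "i \<ge> 1"
  shows "(\<integral>\<^sup>+\<omega>. ennreal (exp (l \<bullet> X i \<omega>)) \<partial>M) = ennreal (exp (\<Lambda> l))"
proof -
  have *: "(\<integral>\<^sup>+\<omega>. ennreal (exp (l \<bullet> X j \<omega>)) \<partial>M) = (\<integral>\<^sup>+x. ennreal (exp (l \<bullet> x)) \<partial>distr M borel (X j))"
    if "j \<ge> 1" for j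
    using measurable_X[OF that] by (subst nn_integral_distr) auto
  have "distr M borel (X i) = distr M borel (X 1)"
    using iid assms unfolding iid_def by blast
  then show ?thesis using *[OF assms] *[of 1] mgf by simp
qed

lemma mgf_sum: "(\<integral>\<^sup>+\<omega>. ennreal (exp (l \<bullet> (\<Sum>i=1..n. X i \<omega>))) \<partial>M) = ennreal (exp (real n * \<Lambda> l))"
proof -
  have "indep_vars (\<lambda>_. borel) X {1..n}"
    using indep_X by (rule indep_vars_subset) auto
  then have indep: "indep_vars (\<lambda>_. borel) (\<lambda>i \<omega>. ennreal (exp (l \<bullet> X i \<omega>))) {1..n}"
    by (rule indep_vars_compose2) auto
  have "(\<integral>\<^sup>+\<omega>. ennreal (exp (l \<bullet> (\<Sum>i=1..n. X i \<omega>))) \<partial>M)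
      = (\<integral>\<^sup>+\<omega>. (\<Prod>i=1..n. ennreal (exp (l \<bullet> X i \<omega>))) \<partial>M)"
    by (simp add: inner_sum_right exp_sum prod_ennreal)
  also have "\<dots> = (\<Prod>i=1..n. \<integral>\<^sup>+\<omega>. ennreal (exp (l \<bullet> X i \<omega>)) \<partial>M)"
    by (intro indep_vars_nn_integral indep) auto
  also have "\<dots> = ennreal (exp (real n * \<Lambda> l))"
    by (simp add: mgf_identical prod_ennreal ennreal_power exp_of_nat_mult)
  finally show ?thesis .
qed

text \<open>
  Markov's inequality for \<open>exp (l \<bullet> S\<^sub>n)\<close>, whose expectation is \<open>exp (n * \<Lambda> l)\<close>, at the level
  \<open>exp (n * (\<Lambda> l + q))\<close>.
\<close>

lemma half_space_Chernoff:
  assumes "n \<ge> 1"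
  shows "prob {\<omega> \<in> space M. q < l \<bullet> sample_mean X n \<omega> - \<Lambda> l} \<le> exp (- q * real n)"
proof -
  let ?S = "\<lambda>\<omega>. \<Sum>i=1..n. X i \<omega>"
  let ?a = "exp (- real n * (\<Lambda> l + q))"
  have [measurable]: "?S \<in> borel_measurable M"
    using measurable_X by (intro borel_measurable_sum) auto
  have S: "?S \<omega> = real n *\<^sub>R sample_mean X n \<omega>" for \<omega>
    using assms by (simp add: sample_mean_def)
  have "emeasure M {\<omega> \<in> space M. q < l \<bullet> sample_mean X n \<omega> - \<Lambda> l}
      \<le> emeasure M {\<omega> \<in> space M. 1 \<le> ennreal ?a * ennreal (exp (l \<bullet> ?S \<omega>))}"
  proof (intro emeasure_mono)
    have "1 \<le> ennreal ?a * ennreal (exp (l \<bullet> ?S \<omega>))" if "q < l \<bullet> sample_mean X n \<omega> - \<Lambda> l" for \<omega>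
    proof -
      have "real n * (\<Lambda> l + q) \<le> real n * (l \<bullet> sample_mean X n \<omega>)"
        using that by (intro mult_left_mono) auto
      then have "1 \<le> ?a * exp (l \<bullet> ?S \<omega>)"
        unfolding S by (simp flip: exp_add)
      then show ?thesis by (simp flip: ennreal_mult' ennreal_1)
    qed
    then show "{\<omega> \<in> space M. q < l \<bullet> sample_mean X n \<omega> - \<Lambda> l}
      \<subseteq> {\<omega> \<in> space M. 1 \<le> ennreal ?a * ennreal (exp (l \<bullet> ?S \<omega>))}" by auto
  qed measurable
  also have "\<dots> \<le> ennreal ?a * (\<integral>\<^sup>+\<omega>. ennreal (exp (l \<bullet> ?S \<omega>)) * indicator (space M) \<omega> \<partial>M)"
    by (intro nn_integral_Markov_inequality) measurable
  also have "(\<integral>\<^sup>+\<omega>. ennreal (exp (l \<bullet> ?S \<omega>)) * indicator (space M) \<omega> \<partial>M) = ennreal (exp (real n * \<Lambda> l))"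
    using mgf_sum[of l n] by (simp cong: nn_integral_cong)
  also have "ennreal ?a * ennreal (exp (real n * \<Lambda> l)) = ennreal (exp (- q * real n))"
    by (simp add: algebra_simps flip: ennreal_mult' exp_add)
  finally show ?thesis by (simp add: emeasure_eq_measure)
qed

text \<open>
  The upper bound of Cramer's theorem for closed sets, as an exponential estimate: the constant \<open>c\<close>
  is the number of half-spaces in a finite cover.
\<close>

lemma sample_mean_closed_set:
  assumes "closed F" and "\<And>x. x \<in> F \<Longrightarrow> \<exists>l. q < l \<bullet> x - \<Lambda> l"
  obtains c where "\<And>n. n \<ge> 1 \<Longrightarrow> prob {\<omega> \<in> space M. sample_mean X n \<omega> \<in> F} \<le> c * exp (- q * real n)"
proof -
  obtain T where T: "finite T" "F \<subseteq> (\<Union>l\<in>T. {x. q < l \<bullet> x - \<Lambda> l})"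
    using finite_half_space_cover[OF assms] by blast
  have "prob {\<omega> \<in> space M. sample_mean X n \<omega> \<in> F} \<le> real (card T) * exp (- q * real n)"
    if "n \<ge> 1" for n
  proof -
    have [measurable]: "sample_mean X n \<in> borel_measurable M" by (rule measurable_sample_mean)
    have "prob {\<omega> \<in> space M. sample_mean X n \<omega> \<in> F}
        \<le> prob (\<Union>l\<in>T. {\<omega> \<in> space M. q < l \<bullet> sample_mean X n \<omega> - \<Lambda> l})"
      using T by (intro finite_measure_mono sets.finite_UN) auto
    also have "\<dots> \<le> (\<Sum>l\<in>T. prob {\<omega> \<in> space M. q < l \<bullet> sample_mean X n \<omega> - \<Lambda> l})"
      using T(1) by (intro finite_measure_subadditive_finite) auto
    also have "\<dots> \<le> (\<Sum>l\<in>T. exp (- q * real n))"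
      by (intro sum_mono half_space_Chernoff that)
    finally show ?thesis by simp
  qed
  then show thesis by (rule that)
qed

section \<open>Positivity of the rate and the strong law\<close>

lemma integrable_exp_inner: "integrable M (\<lambda>\<omega>. exp (l \<bullet> X 1 \<omega>))"
proof (rule integrableI_nonneg)
  note measurable_X[OF order_refl, measurable]
  show "(\<lambda>\<omega>. exp (l \<bullet> X 1 \<omega>)) \<in> borel_measurable M" by measurable
  show "(\<integral>\<^sup>+\<omega>. ennreal (exp (l \<bullet> X 1 \<omega>)) \<partial>M) < \<infinity>" unfolding mgf by simp
qed simp

lemma expectation_exp_inner: "expectation (\<lambda>\<omega>. exp (l \<bullet> X 1 \<omega>)) = exp (\<Lambda> l)"
proof -
  have "ennreal (expectation (\<lambda>\<omega>. exp (l \<bullet> X 1 \<omega>))) = ennreal (exp (\<Lambda> l))"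
    unfolding mgf[symmetric]
    by (rule nn_integral_eq_integral[symmetric]) (auto intro: integrable_exp_inner[unfolded One_nat_def])
  then show ?thesis
    by (subst (asm) ennreal_inj) (auto intro: integral_nonneg_AE)
qed

lemma integrable_exp_norm: "integrable M (\<lambda>\<omega>. exp (c * norm (X 1 \<omega>)))"
proof -
  note measurable_X[OF order_refl, measurable]
  let ?D = "real DIM(real ^ 'd)"
  let ?B = "\<lambda>\<omega>. \<Sum>b\<in>Basis. exp ((?D *\<^sub>R b) \<bullet> (c *\<^sub>R X 1 \<omega>)) + exp ((- ?D *\<^sub>R b) \<bullet> (c *\<^sub>R X 1 \<omega>))"
  have scale: "l \<bullet> (c *\<^sub>R X 1 \<omega>) = (c *\<^sub>R l) \<bullet> X 1 \<omega>" for l \<omega>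
    by (simp only: inner_scaleR_left inner_scaleR_right)
  have "integrable M ?B"
    unfolding scale
    by (intro Bochner_Integration.integrable_sum Bochner_Integration.integrable_add integrable_exp_inner)
  then show ?thesis
  proof (rule Bochner_Integration.integrable_bound)
    have "exp (c * norm (X 1 \<omega>)) \<le> ?B \<omega>" for \<omega>
    proof -
      have "exp (c * norm (X 1 \<omega>)) \<le> exp (norm (c *\<^sub>R X 1 \<omega>))"
        by (simp add: mult_right_mono)
      also note exp_norm_le_sum_Basis
      finally show ?thesis .
    qed
    moreover have "r \<le> norm t" if "r \<le> t" for r t :: real using that by simp
    ultimately show "AE \<omega> in M. norm (exp (c * norm (X 1 \<omega>))) \<le> norm (?B \<omega>)"
      by (intro AE_I2) (simp only: real_norm_def abs_exp_cancel)
  qed measurable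
qed

lemma integrable_X: "integrable M (X 1)"
proof (rule Bochner_Integration.integrable_bound[OF integrable_exp_norm[of 1]])
  have "norm x \<le> exp (norm x)" for x :: "real ^ 'd"
    using exp_ge_add_one_self[of "norm x"] by linarith
  then show "AE \<omega> in M. norm (X 1 \<omega>) \<le> norm (exp (1 * norm (X 1 \<omega>)))"
    by simp
qed (rule measurable_X, rule order_refl)

text \<open>
  The first-order term of the moment generating function of \<open>Y = X 1 - \<mu>\<close> vanishes because \<open>Y\<close> is
  centred, and the remainder is bounded by \<open>(norm l)\<^sup>2 * E[exp (2 * norm Y)]\<close>.
\<close>

lemma cumulant_le_quadratic:
  obtains K where "K > 0" "\<And>l. norm l \<le> 1 \<Longrightarrow> \<Lambda> l \<le> l \<bullet> \<mu> + K * (norm l)\<^sup>2"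
proof -
  note measurable_X[OF order_refl, measurable]
  define Y where "Y \<omega> = X 1 \<omega> - \<mu>" for \<omega>
  have [measurable]: "Y \<in> borel_measurable M" unfolding Y_def[abs_def] by measurable
  define K where "K = expectation (\<lambda>\<omega>. exp (2 * norm (Y \<omega>)))"
  have int: "integrable M (\<lambda>\<omega>. exp (2 * norm (Y \<omega>)))"
  proof (rule Bochner_Integration.integrable_bound)
    show "integrable M (\<lambda>\<omega>. exp (2 * norm \<mu>) * exp (2 * norm (X 1 \<omega>)))"
      by (intro integrable_mult_right integrable_exp_norm)
    show "AE \<omega> in M. norm (exp (2 * norm (Y \<omega>))) \<le> norm (exp (2 * norm \<mu>) * exp (2 * norm (X 1 \<omega>)))"
      unfolding Y_def
    proof (intro AE_I2)
      fix \<omega>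
      have "2 * norm (X 1 \<omega> - \<mu>) \<le> 2 * norm \<mu> + 2 * norm (X 1 \<omega>)"
        using norm_triangle_ineq4[of "X 1 \<omega>" \<mu>] by linarith
      then show "norm (exp (2 * norm (X 1 \<omega> - \<mu>))) \<le> norm (exp (2 * norm \<mu>) * exp (2 * norm (X 1 \<omega>)))"
        by (simp flip: exp_add)
    qed
  qed measurable
  have "expectation (\<lambda>_. 1) \<le> K"
    unfolding K_def by (intro integral_mono int) auto
  then have "K > 0" by (simp add: prob_space)
  have "\<Lambda> l \<le> l \<bullet> \<mu> + K * (norm l)\<^sup>2" if "norm l \<le> 1" for l
  proof -
    have lY: "exp (l \<bullet> Y \<omega>) = exp (- (l \<bullet> \<mu>)) * exp (l \<bullet> X 1 \<omega>)" for \<omega>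
      by (simp add: Y_def inner_diff_right flip: exp_add)
    have iY: "integrable M (\<lambda>\<omega>. l \<bullet> Y \<omega>)"
      unfolding Y_def using integrable_X by simp
    have mean: "expectation (\<lambda>\<omega>. l \<bullet> Y \<omega>) = 0"
      unfolding Y_def using integrable_X by (simp add: prob_space)
    have "exp (- (l \<bullet> \<mu>)) * exp (\<Lambda> l) = expectation (\<lambda>\<omega>. exp (l \<bullet> Y \<omega>))"
      unfolding lY by (simp add: expectation_exp_inner del: One_nat_def)
    also have "\<dots> \<le> expectation (\<lambda>\<omega>. 1 + l \<bullet> Y \<omega> + (norm l)\<^sup>2 * exp (2 * norm (Y \<omega>)))"
    proof (rule integral_mono)
      show "integrable M (\<lambda>\<omega>. exp (l \<bullet> Y \<omega>))"
        unfolding lY by (intro integrable_mult_right integrable_exp_inner)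
    qed (use iY int exp_inner_le_quadratic[OF that] in auto)
    also have "\<dots> = 1 + (norm l)\<^sup>2 * K"
      using iY int by (simp add: mean K_def prob_space)
    also have "\<dots> \<le> exp ((norm l)\<^sup>2 * K)" by (rule exp_ge_add_one_self)
    finally show ?thesis by (simp add: mult.commute flip: exp_add)
  qed
  with \<open>K > 0\<close> show thesis by (rule that)
qed

text \<open>
  Choose \<open>l\<close> of length \<open>s\<close> in the direction of \<open>x - \<mu>\<close>. Then \<open>l \<bullet> x - \<Lambda> l\<close> is at least
  \<open>s * \<epsilon> - K * s\<^sup>2\<close>: for small \<open>s\<close> the linear gain outweighs the quadratic loss.
\<close>

lemma deviation_separation:
  assumes "\<epsilon> > 0"
  obtains q where "q > 0" "\<And>x. norm (x - \<mu>) \<ge> \<epsilon> \<Longrightarrow> \<exists>l. q < l \<bullet> x - \<Lambda> l"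
proof -
  obtain K where K: "K > 0" "\<And>l. norm l \<le> 1 \<Longrightarrow> \<Lambda> l \<le> l \<bullet> \<mu> + K * (norm l)\<^sup>2"
    using cumulant_le_quadratic by blast
  \<comment> \<open>The second bound on \<open>s\<close> makes the loss \<open>K * s\<^sup>2\<close> at most half of the gain \<open>s * \<epsilon>\<close>; the
    first one is the range in which the quadratic estimate holds. Half of the gain remains, hence a
    quarter of it is a strict lower bound.\<close>
  define s where "s = min 1 (\<epsilon> / (2 * K))"
  have s: "0 < s" "s \<le> 1" "K * s \<le> \<epsilon> / 2"
    using assms K(1) by (auto simp: s_def min_def field_simps)
  have "\<exists>l. s * \<epsilon> / 4 < l \<bullet> x - \<Lambda> l" if "norm (x - \<mu>) \<ge> \<epsilon>" for x
  proof
    define l where "l = (s / norm (x - \<mu>)) *\<^sub>R (x - \<mu>)"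
    have nz: "norm (x - \<mu>) > 0" using that assms by linarith
    have norm_l: "norm l = s" using nz s by (simp add: l_def)
    have "l \<bullet> (x - \<mu>) = s * norm (x - \<mu>)"
      using nz by (simp add: l_def power2_norm_eq_inner[symmetric] power2_eq_square)
    moreover have "s * \<epsilon> \<le> s * norm (x - \<mu>)" using that s by (intro mult_left_mono) auto
    moreover have "K * s\<^sup>2 \<le> s * \<epsilon> / 2"
      using mult_left_mono[OF s(3), of s] s(1) by (simp add: power2_eq_square mult_ac)
    moreover have "0 < s * \<epsilon>" using s assms by simp
    ultimately show "s * \<epsilon> / 4 < l \<bullet> x - \<Lambda> l"
      using K(2)[of l] norm_l s(2) by (simp add: inner_diff_right)
  qed
  with s(1) assms show thesis by (intro that[of "s * \<epsilon> / 4"]) auto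
qed

definition "deviation \<epsilon> n = {\<omega> \<in> space M. norm (sample_mean X n \<omega> - \<mu>) \<ge> \<epsilon>}"

lemma deviation_event: "deviation \<epsilon> n \<in> events"
proof -
  have [measurable]: "sample_mean X n \<in> borel_measurable M" by (rule measurable_sample_mean)
  show ?thesis unfolding deviation_def by measurable
qed

lemma prob_deviation_le:
  assumes "\<And>x. norm (x - \<mu>) \<ge> \<epsilon> \<Longrightarrow> \<exists>l. q < l \<bullet> x - \<Lambda> l"
  obtains c where "\<And>n. n \<ge> 1 \<Longrightarrow> prob (deviation \<epsilon> n) \<le> c * exp (- q * real n)"
proof -
  have "closed {x. norm (x - \<mu>) \<ge> \<epsilon>}"
    by (intro closed_Collect_le continuous_intros)
  moreover have "\<exists>l. q < l \<bullet> x - \<Lambda> l" if "x \<in> {x. norm (x - \<mu>) \<ge> \<epsilon>}" for x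
    using that unfolding mem_Collect_eq by (rule assms)
  ultimately show thesis
  proof (rule sample_mean_closed_set)
    fix c
    assume "\<And>n. n \<ge> 1 \<Longrightarrow>
      prob {\<omega> \<in> space M. sample_mean X n \<omega> \<in> {x. norm (x - \<mu>) \<ge> \<epsilon>}} \<le> c * exp (- q * real n)"
    then show thesis
      unfolding mem_Collect_eq deviation_def[symmetric] by (rule that)
  qed
qed

lemma eventually_no_deviation:
  assumes "\<epsilon> > 0"
  shows "AE \<omega> in M. \<forall>\<^sub>F n in sequentially. norm (sample_mean X n \<omega> - \<mu>) < \<epsilon>"
proof -
  obtain q where q: "q > 0" "\<And>x. norm (x - \<mu>) \<ge> \<epsilon> \<Longrightarrow> \<exists>l. q < l \<bullet> x - \<Lambda> l"
    using deviation_separation[OF assms] by blast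
  obtain c where c: "\<And>n. n \<ge> 1 \<Longrightarrow> prob (deviation \<epsilon> n) \<le> c * exp (- q * real n)"
    using prob_deviation_le[OF q(2)] by blast
  have exp_power: "exp (- q * real n) = exp (- q) ^ n" for n
    using exp_of_nat_mult[of n "- q"] by (simp add: mult.commute)
  have "summable (\<lambda>n. c * exp (- q * real n))"
    unfolding exp_power using \<open>q > 0\<close> by (intro summable_mult summable_geometric) auto
  then have "summable (\<lambda>n. prob (deviation \<epsilon> n))"
    by (rule summable_comparison_test'[where N = 1]) (simp add: c[simplified])
  then have "AE \<omega> in M. \<forall>\<^sub>F n in sequentially. \<omega> \<in> space M - deviation \<epsilon> n"
    using deviation_event by (intro borel_cantelli_AE1) (auto simp: emeasure_eq_measure)
  then show ?thesis
    by (rule AE_mp) (auto simp: deviation_def intro!: AE_I2 elim!: eventually_mono)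
qed

lemma strong_law: "AE \<omega> in M. (\<lambda>n. sample_mean X n \<omega>) \<longlonglongrightarrow> \<mu>"
proof -
  have "AE \<omega> in M. \<forall>k. \<forall>\<^sub>F n in sequentially. norm (sample_mean X n \<omega> - \<mu>) < 1 / real (Suc k)"
    unfolding AE_all_countable by (intro allI eventually_no_deviation) simp
  then show ?thesis
  proof (rule AE_mp, intro AE_I2 impI)
    fix \<omega> assume *: "\<forall>k. \<forall>\<^sub>F n in sequentially. norm (sample_mean X n \<omega> - \<mu>) < 1 / real (Suc k)"
    show "(\<lambda>n. sample_mean X n \<omega>) \<longlonglongrightarrow> \<mu>"
    proof (rule tendstoI)
      fix e :: real assume "e > 0"
      then obtain k where "1 / real (Suc k) < e" by (rule nat_approx_posE)
      with * show "\<forall>\<^sub>F n in sequentially. dist (sample_mean X n \<omega>) \<mu> < e"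
        unfolding dist_norm by (auto elim!: allE[of _ k] eventually_mono)
    qed
  qed
qed

section \<open>The mean deviation frequency\<close>

text \<open>
  Intersecting with the sample space turns the sets that are counted into events.
\<close>

lemma dev_count_eq:
  assumes "\<omega> \<in> space M"
  shows "dev_count M X \<epsilon> \<omega> = (\<Sum>n. indicator (deviation \<epsilon> (Suc n)) \<omega>)"
  using assms by (simp add: dev_count_def deviation_def indicator_def)

text \<open>
  Below the rate, every deviating point is separated from the mean by a half-space of the kind that
  Chernoff's inequality controls: this is the only way in which the Legendre transform enters.
\<close>

lemma dev_rate_separation:
  assumes cumulant: "\<And>l. cumulant M (X 1) l = ereal (\<Lambda> l)"
    and "ereal q < dev_rate M X \<epsilon>" "norm (x - \<mu>) \<ge> \<epsilon>"
  shows "\<exists>l. q < l \<bullet> x - \<Lambda> l"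
proof -
  have "ereal q < legendre (cumulant M (X 1)) x"
    using assms(2,3) unfolding dev_rate_def by (auto dest: less_INF_D)
  then show ?thesis
    unfolding legendre_def less_SUP_iff cumulant by auto
qed

lemma exp_moment_dev_count_finite:
  assumes cumulant: "\<And>l. cumulant M (X 1) l = ereal (\<Lambda> l)"
    and "0 < p" "ereal p < dev_rate M X \<epsilon>"
  shows "(\<integral>\<^sup>+\<omega>. exp_ereal (ereal p * enn2ereal (dev_count M X \<epsilon> \<omega>)) \<partial>M) < top"
proof -
  obtain q where q: "p < q" "ereal q < dev_rate M X \<epsilon>"
    using ereal_dense2[OF assms(3)] by auto
  obtain c where c: "\<And>n. n \<ge> 1 \<Longrightarrow> prob (deviation \<epsilon> n) \<le> c * exp (- q * real n)"
    using prob_deviation_le[OF dev_rate_separation[OF cumulant q(2)]] by blast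
  have "(\<integral>\<^sup>+\<omega>. exp_ereal (ereal p * enn2ereal (\<Sum>n. indicator (deviation \<epsilon> (Suc n)) \<omega>)) \<partial>M) < top"
    using assms(2) q(1) by (intro exp_moment_count_finite[where c = c and q = q] deviation_event c) auto
  also have "(\<integral>\<^sup>+\<omega>. exp_ereal (ereal p * enn2ereal (\<Sum>n. indicator (deviation \<epsilon> (Suc n)) \<omega>)) \<partial>M)
      = (\<integral>\<^sup>+\<omega>. exp_ereal (ereal p * enn2ereal (dev_count M X \<epsilon> \<omega>)) \<partial>M)"
    by (intro nn_integral_cong) (simp only: dev_count_eq)
  finally show ?thesis .
qed

lemma prob_dev_count_ge_le:
  assumes "p > 0"
  shows "emeasure M {\<omega> \<in> space M. dev_count M X \<epsilon> \<omega> \<ge> of_nat k}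
    \<le> (\<integral>\<^sup>+\<omega>. exp_ereal (ereal p * enn2ereal (dev_count M X \<epsilon> \<omega>)) \<partial>M) * ennreal (exp (- (p * real k)))"
    (is "emeasure M ?S \<le> ?E * _")
proof -
  note deviation_event[measurable]
  have "(\<lambda>\<omega>. \<Sum>n. indicator (deviation \<epsilon> (Suc n)) \<omega> :: ennreal) \<in> borel_measurable M"
    by measurable
  then have [measurable]: "dev_count M X \<epsilon> \<in> borel_measurable M"
    by (simp cong: measurable_cong add: dev_count_eq)
  have "ennreal (exp (p * real k)) * emeasure M ?S = (\<integral>\<^sup>+\<omega>. ennreal (exp (p * real k)) * indicator ?S \<omega> \<partial>M)"
    by (subst nn_integral_cmult_indicator) auto
  also have "\<dots> \<le> ?E"
  proof (intro nn_integral_mono)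
    fix \<omega>
    have "ennreal (exp (p * real k)) \<le> exp_ereal (ereal p * enn2ereal (dev_count M X \<epsilon> \<omega>))"
      if "of_nat k \<le> dev_count M X \<epsilon> \<omega>"
    proof -
      have "ereal (real k) \<le> enn2ereal (dev_count M X \<epsilon> \<omega>)"
        using that ennreal_of_nat_eq_real_of_nat[of k]
        by (cases "dev_count M X \<epsilon> \<omega>") (auto simp: top_ereal_def)
      then have "ereal p * ereal (real k) \<le> ereal p * enn2ereal (dev_count M X \<epsilon> \<omega>)"
        using assms by (intro ereal_mult_left_mono) auto
      from exp_ereal_mono[OF this] show ?thesis by (simp add: exp_ereal_def)
    qed
    then show "ennreal (exp (p * real k)) * indicator ?S \<omega>
        \<le> exp_ereal (ereal p * enn2ereal (dev_count M X \<epsilon> \<omega>))"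
      by (auto simp: indicator_def)
  qed
  finally have "ennreal (exp (p * real k)) * emeasure M ?S * ennreal (exp (- (p * real k)))
      \<le> ?E * ennreal (exp (- (p * real k)))"
    by (rule mult_right_mono) simp
  moreover have "ennreal (exp (p * real k)) * emeasure M ?S * ennreal (exp (- (p * real k))) = emeasure M ?S"
  proof -
    have "ennreal (exp (p * real k)) * ennreal (exp (- (p * real k))) = 1"
      by (simp flip: ennreal_mult' exp_add)
    then show ?thesis by (simp only: mult.commute[of _ "emeasure M ?S"] mult.assoc mult_1_right)
  qed
  ultimately show ?thesis by simp
qed

end

lemma dev_bound_finite:
  assumes "p > 0" "ereal p < dev_rate M X \<epsilon>"
  shows "dev_bound M X \<epsilon> p C < \<infinity>" "ennreal C \<le> dev_bound M X \<epsilon> p C"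
proof -
  let ?r = "dev_rate M X \<epsilon>"
  have "- ?r < 0" "- (?r - ereal p) < 0"
    using assms by (cases ?r; simp)+
  note inv = this[THEN inverse_one_minus_exp_ereal(1)] this[THEN inverse_one_minus_exp_ereal(2)]
  show "dev_bound M X \<epsilon> p C < \<infinity>"
    unfolding dev_bound_def using inv by (simp add: ennreal_mult_less_top)
  have "ennreal C * 1 * 1 \<le> dev_bound M X \<epsilon> p C"
    unfolding dev_bound_def using inv by (intro mult_mono) auto
  then show "ennreal C \<le> dev_bound M X \<epsilon> p C" by simp
qed

lemma (in prob_space) cumulant_finite_mgf:
  assumes "Y \<in> borel_measurable M" "cumulant M Y l < \<infinity>"
  obtains a where "cumulant M Y l = ereal a" "(\<integral>\<^sup>+\<omega>. ennreal (exp (l \<bullet> Y \<omega>)) \<partial>M) = ennreal (exp a)"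
proof -
  note assms(1)[measurable]
  let ?m = "\<integral>\<^sup>+\<omega>. ennreal (exp (l \<bullet> Y \<omega>)) \<partial>M"
  have "?m \<noteq> 0" by (subst nn_integral_0_iff_AE) auto
  moreover from this assms(2) have "?m \<noteq> top" by (auto simp: cumulant_def ln_ennreal_def)
  ultimately show thesis
    by (intro that[of "ln (enn2real ?m)"])
      (auto simp: cumulant_def ln_ennreal_def enn2real_positive_iff less_top zero_less_iff_neq_zero)
qed

theorem theorem9:
  fixes M :: "'a measure" and X :: "nat \<Rightarrow> 'a \<Rightarrow> real ^ 'd"
  assumes "prob_space M"
    and "iid M X"
    and "\<forall>l. cumulant M (X 1) l < \<infinity>"
  shows "(AE \<omega> in M. (\<lambda>n. sample_mean X n \<omega>) \<longlonglongrightarrow> (\<integral>\<omega>'. X 1 \<omega>' \<partial>M)) \<and>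
    (\<forall>\<epsilon>>0. \<forall>p>0. ereal p < dev_rate M X \<epsilon> \<longrightarrow>
      (\<exists>C>0.
         (\<integral>\<^sup>+\<omega>. exp_ereal (ereal p * enn2ereal (dev_count M X \<epsilon> \<omega>)) \<partial>M) \<le> dev_bound M X \<epsilon> p C \<and>
         dev_bound M X \<epsilon> p C < \<infinity> \<and>
         (\<forall>k::nat. k \<ge> 1 \<longrightarrow>
            emeasure M {\<omega> \<in> space M. dev_count M X \<epsilon> \<omega> \<ge> of_nat k}
              \<le> dev_bound M X \<epsilon> p C * ennreal (exp (- (p * real k))))))"
proof -
  interpret prob_space M by fact
  have "X 1 \<in> borel_measurable M"
    using assms(2) unfolding iid_def indep_vars_def by blast
  then have "\<forall>l. \<exists>a. cumulant M (X 1) l = ereal a \<and> (\<integral>\<^sup>+\<omega>. ennreal (exp (l \<bullet> X 1 \<omega>)) \<partial>M) = ennreal (exp a)"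
    using assms(3) cumulant_finite_mgf by metis
  then obtain \<Lambda> where \<Lambda>: "\<And>l. cumulant M (X 1) l = ereal (\<Lambda> l)"
      "\<And>l. (\<integral>\<^sup>+\<omega>. ennreal (exp (l \<bullet> X 1 \<omega>)) \<partial>M) = ennreal (exp (\<Lambda> l))"
    by metis
  interpret iid_exponential_moments M X \<Lambda>
    by unfold_locales (fact assms(2) \<Lambda>(2))+
  show ?thesis
  proof (intro conjI allI impI)
    show "AE \<omega> in M. (\<lambda>n. sample_mean X n \<omega>) \<longlonglongrightarrow> \<mu>" by (rule strong_law)
  next
    fix \<epsilon> p :: real
    assume p: "0 < p" "ereal p < dev_rate M X \<epsilon>"
    let ?E = "\<integral>\<^sup>+\<omega>. exp_ereal (ereal p * enn2ereal (dev_count M X \<epsilon> \<omega>)) \<partial>M"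
    define C where "C = enn2real ?E + 1"
    have "C > 0" by (simp add: C_def add_nonneg_pos)
    have "?E = ennreal (enn2real ?E)"
      using exp_moment_dev_count_finite[OF \<Lambda>(1) p] by simp
    also have "\<dots> \<le> ennreal C" unfolding C_def by (intro ennreal_leI) simp
    also have "\<dots> \<le> dev_bound M X \<epsilon> p C" by (rule dev_bound_finite[OF p])
    finally have E: "?E \<le> dev_bound M X \<epsilon> p C" .
    have "emeasure M {\<omega> \<in> space M. dev_count M X \<epsilon> \<omega> \<ge> of_nat k}
        \<le> dev_bound M X \<epsilon> p C * ennreal (exp (- (p * real k)))" for k
      using prob_dev_count_ge_le[OF p(1)] mult_right_mono[OF E] by (rule order_trans) simp
    then show "\<exists>C>0. ?E \<le> dev_bound M X \<epsilon> p C \<and> dev_bound M X \<epsilon> p C < \<infinity> \<and>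
         (\<forall>k::nat. k \<ge> 1 \<longrightarrow>
            emeasure M {\<omega> \<in> space M. dev_count M X \<epsilon> \<omega> \<ge> of_nat k}
              \<le> dev_bound M X \<epsilon> p C * ennreal (exp (- (p * real k))))"
      using \<open>C > 0\<close> E dev_bound_finite(1)[OF p] by blast
  qed
qed

end
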